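(* Let $\mathcal{O}$ be a local principal ideal ring, complete with respect to its maximal ideal $\mathfrak{m}=(\pi)$, with residue field $k=\mathcal{O}/\mathfrak{m}$ of characteristic $\neq 2$, and let $m\geq 1$ be a positive integer. Let $e_{m+1}^{\mathcal{O}}\colon \mathrm{M}_2(\mathcal{O})\times \mathrm{M}_2(\mathcal{O})\to \mathrm{M}_2(\mathcal{O})$ and $\bar e_{m+1}\colon \mathrm{M}_2(k)\times \mathrm{M}_2(k)\to \mathrm{M}_2(k)$ be the $(m+1)$-th Engel maps. Then $\mathrm{Im}(e_{m+1}^{\mathcal{O}})=\mathfrak{sl}_2^{\circ}(\mathcal{O})$ if and only if $\mathrm{Im}(\bar e_{m+1})=\mathfrak{sl}_2(k)$.
   Context: Rings are commutative with unity. $\mathcal{O}$ is complete with respect to $\mathfrak{m}$ if the canonical map $\mathcal{O}\to\varprojlim_{j\ge 1}\mathcal{O}/\mathfrak{m}^j$ is an isomorphism. For a commutative ring $\mathcal{R}$ with unity, the Engel maps $e_r^{\mathcal{R}}\colon \mathrm{M}_2(\mathcal{R})\times \mathrm{M}_2(\mathcal{R})\to \mathrm{M}_2(\mathcal{R})$ are defined by $e_1^{\mathcal{R}}(X,Y)=XY-YX$ and $e_{r+1}^{\mathcal{R}}(X,Y)=e_r^{\mathcal{R}}(X,Y)\,Y-Y\,e_r^{\mathcal{R}}(X,Y)$ for $r\ge 1$; write $\bar e_r=e_r^{k}$. Here $\mathfrak{sl}_2^{\circ}(\mathcal{O})=\{A\in \mathrm{M}_2(\mathcal{O})\mid \mathrm{tr}(A)=0\}$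 and $\mathfrak{sl}_2(k)=\{A\in \mathrm{M}_2(k)\mid \mathrm{tr}(A)=0\}$. $\mathrm{Im}$ denotes the image of the map on all pairs of $2\times 2$ matrices. *)

theory Defs
  imports
    "HOL-Analysis.Finite_Cartesian_Product"
    "HOL-Algebra.Algebra"
begin

section \<open>Local principal ideal rings\<close>

text \<open>Rings are commutative with unity. A principal ideal ring may have zero divisors.\<close>

definition principal_ideal_ring :: "('a, 'b) ring_scheme \<Rightarrow> bool" where
  "principal_ideal_ring R \<longleftrightarrow> cring R \<and> (\<forall>I. ideal I R \<longrightarrow> principalideal I R)"

definition local_ring_with :: "('a, 'b) ring_scheme \<Rightarrow> 'a set \<Rightarrow> bool" where
  "local_ring_with R M \<longleftrightarrow> cring R \<and> {I. maximalideal I R} = {M}"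

text \<open>The characteristic is the additive order of the unit element;
  \<open>group.ord\<close> is 0 for elements of infinite order.\<close>

definition characteristic :: "('a, 'b) ring_scheme \<Rightarrow> nat" where
  "characteristic R = group.ord (add_monoid R) \<one>\<^bsub>R\<^esub>"


section \<open>Adic completeness\<close>

primrec ideal_pow :: "('a, 'b) ring_scheme \<Rightarrow> 'a set \<Rightarrow> nat \<Rightarrow> 'a set" where
  "ideal_pow R I 0 = carrier R"
| "ideal_pow R I (Suc n) = ideal_prod R (ideal_pow R I n) I"

definition quot_map :: "('a, 'b) ring_scheme \<Rightarrow> 'a set \<Rightarrow> 'a \<Rightarrow> 'a set" where
  "quot_map R I a = I +>\<^bsub>R\<^esub> a"

text \<open>For ideals \<open>J \<subseteq> I\<close>, the map \<open>R/J \<rightarrow> R/I\<close> induced by \<open>quot_map R I\<close>.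
  On a coset of \<open>J\<close> the image below is a singleton.\<close>

definition quot_transition :: "('a, 'b) ring_scheme \<Rightarrow> 'a set \<Rightarrow> 'a set \<Rightarrow> 'a set" where
  "quot_transition R I C = the_elem (quot_map R I ` C)"

text \<open>The ring \<open>lim R/I\<^sup>j\<close> of compatible families indexed by \<open>j \<ge> 1\<close>, with componentwise
  operations.\<close>

definition adic_limit :: "('a, 'b) ring_scheme \<Rightarrow> 'a set \<Rightarrow> (nat \<Rightarrow> 'a set) ring" where
  "adic_limit R I =
    \<lparr>carrier = {x \<in> (\<Pi>\<^sub>E j\<in>{1..}. carrier (R Quot (ideal_pow R I j))).
        \<forall>i j. 1 \<le> i \<longrightarrow> i \<le> j \<longrightarrow> quot_transition R (ideal_pow R I i) (x j) = x i},
     monoid.mult = (\<lambda>x y. \<lambda>j\<in>{1..}. x j \<otimes>\<^bsub>R Quot (ideal_pow R I j)\<^esub> y j),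
     monoid.one = (\<lambda>j\<in>{1..}. \<one>\<^bsub>R Quot (ideal_pow R I j)\<^esub>),
     ring.zero = (\<lambda>j\<in>{1..}. \<zero>\<^bsub>R Quot (ideal_pow R I j)\<^esub>),
     ring.add = (\<lambda>x y. \<lambda>j\<in>{1..}. x j \<oplus>\<^bsub>R Quot (ideal_pow R I j)\<^esub> y j)\<rparr>"

definition adic_complete :: "('a, 'b) ring_scheme \<Rightarrow> 'a set \<Rightarrow> bool" where
  "adic_complete R I \<longleftrightarrow>
    (\<lambda>a. \<lambda>j\<in>{1..}. quot_map R (ideal_pow R I j) a) \<in> ring_iso R (adic_limit R I)"


section \<open>Matrices of size two over a ring\<close>

text \<open>Since rings are records here (the residue field is \<open>R Quot M\<close>), the operations are
  those of the record and not the type-class operations on \<open>'a^2^2\<close>.\<close>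

definition mat2 :: "('a, 'b) ring_scheme \<Rightarrow> ('a^2^2) set" where
  "mat2 R = {A. \<forall>i j. A $ i $ j \<in> carrier R}"

definition mat2_mult :: "('a, 'b) ring_scheme \<Rightarrow> 'a^2^2 \<Rightarrow> 'a^2^2 \<Rightarrow> 'a^2^2" where
  "mat2_mult R A B = (\<chi> i j. \<Oplus>\<^bsub>R\<^esub>l\<in>UNIV. A $ i $ l \<otimes>\<^bsub>R\<^esub> B $ l $ j)"

definition mat2_minus :: "('a, 'b) ring_scheme \<Rightarrow> 'a^2^2 \<Rightarrow> 'a^2^2 \<Rightarrow> 'a^2^2" where
  "mat2_minus R A B = (\<chi> i j. A $ i $ j \<ominus>\<^bsub>R\<^esub> B $ i $ j)"

definition mat2_trace :: "('a, 'b) ring_scheme \<Rightarrow> 'a^2^2 \<Rightarrow> 'a" where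
  "mat2_trace R A = (\<Oplus>\<^bsub>R\<^esub>i\<in>UNIV. A $ i $ i)"

definition sl2 :: "('a, 'b) ring_scheme \<Rightarrow> ('a^2^2) set" where
  "sl2 R = {A \<in> mat2 R. mat2_trace R A = \<zero>\<^bsub>R\<^esub>}"

text \<open>\<open>engel R r\<close> is \<open>e\<^sub>r\<close> for \<open>r \<ge> 1\<close>. The value at 0 is a convention chosen so that
  \<open>e\<^sub>1(A,B) = AB - BA\<close>.\<close>

primrec engel :: "('a, 'b) ring_scheme \<Rightarrow> nat \<Rightarrow> 'a^2^2 \<Rightarrow> 'a^2^2 \<Rightarrow> 'a^2^2" where
  "engel R 0 A B = A"
| "engel R (Suc r) A B =
    mat2_minus R (mat2_mult R (engel R r A B) B) (mat2_mult R B (engel R r A B))"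

definition engel_image :: "('a, 'b) ring_scheme \<Rightarrow> nat \<Rightarrow> ('a^2^2) set" where
  "engel_image R r = (\<lambda>(A, B). engel R r A B) ` (mat2 R \<times> mat2 R)"

end

theory Submission
  imports Defs "HOL-Analysis.Cartesian_Space"
begin

text \<open>
  Both images are always the full space of traceless matrices. For traceless \<open>Y\<close> with
  \<open>Y\<^sup>2 = d I\<close>, a traceless \<open>Z\<close> that is orthogonal to \<open>Y\<close> for the trace form anticommutes with \<open>Y\<close>,
  so \<open>ad Y\<close> preserves the orthogonal complement of \<open>Y\<close> and its square acts there as \<open>4 d\<close>. If \<open>2\<close> and
  \<open>d\<close> are units, every iterated commutator with \<open>Y\<close> is thus onto this complement. Over a local ring
  in which \<open>2\<close> is a unit, each traceless matrix with a unit among its entries is orthogonal to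
  some \<open>Y\<close> with \<open>d\<close> a unit, and over a local principal ideal ring or a field every traceless matrix
  is a scalar multiple of such a matrix.
\<close>

section \<open>Coordinates of traceless matrices\<close>

definition traceless2 :: "('a, 'b) ring_scheme \<Rightarrow> 'a \<Rightarrow> 'a \<Rightarrow> 'a \<Rightarrow> 'a^2^2" where
  "traceless2 R a b c =
    (\<chi> i j. if i = 1 then (if j = 1 then a else b) else (if j = 1 then c else \<ominus>\<^bsub>R\<^esub> a))"

text \<open>A triple stands for the three free entries of a traceless matrix. The condition is
  phrased without ideals so that the local ring and its residue field can share
  \<open>engel_image_eq_sl2\<close>. The zero triple is covered by
  \<open>g = \<zero>\<close>.\<close>

definition unimodular_multiples :: "('a, 'b) ring_scheme \<Rightarrow> bool" where
  "unimodular_multiples R \<longleftrightarrow>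
    (\<forall>a \<in> carrier R. \<forall>b \<in> carrier R. \<forall>c \<in> carrier R.
      \<exists>g \<in> carrier R. \<exists>x \<in> carrier R. \<exists>y \<in> carrier R. \<exists>z \<in> carrier R.
        a = g \<otimes>\<^bsub>R\<^esub> x \<and> b = g \<otimes>\<^bsub>R\<^esub> y \<and> c = g \<otimes>\<^bsub>R\<^esub> z \<and>
        (x \<in> Units R \<or> y \<in> Units R \<or> z \<in> Units R))"

lemma traceless2_nth [simp]:
  "traceless2 R a b c $ 1 $ 1 = a" "traceless2 R a b c $ 1 $ 2 = b"
  "traceless2 R a b c $ 2 $ 1 = c" "traceless2 R a b c $ 2 $ 2 = \<ominus>\<^bsub>R\<^esub> a"
  by (simp_all add: traceless2_def)

lemma mat2_eqI:
  fixes A B :: "'a^2^2"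
  assumes "A $ 1 $ 1 = B $ 1 $ 1" "A $ 1 $ 2 = B $ 1 $ 2" "A $ 2 $ 1 = B $ 2 $ 1" "A $ 2 $ 2 = B $ 2 $ 2"
  shows "A = B"
  using assms by (simp add: vec_eq_iff forall_2)

lemma in_mat2_iff:
  "A \<in> mat2 R \<longleftrightarrow> A $ 1 $ 1 \<in> carrier R \<and> A $ 1 $ 2 \<in> carrier R \<and>
    A $ 2 $ 1 \<in> carrier R \<and> A $ 2 $ 2 \<in> carrier R"
  by (auto simp: mat2_def forall_2)

section \<open>Arithmetic of two by two matrices over a commutative ring\<close>

context cring
begin

lemma finsum_UNIV_2:
  assumes "f 1 \<in> carrier R" "f 2 \<in> carrier R"
  shows "finsum R f (UNIV :: 2 set) = f 1 \<oplus> f 2"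
  using assms by (simp add: UNIV_2)

lemma mat2_mult_nth:
  assumes "A \<in> mat2 R" "B \<in> mat2 R"
  shows "mat2_mult R A B $ i $ j = A $ i $ 1 \<otimes> B $ 1 $ j \<oplus> A $ i $ 2 \<otimes> B $ 2 $ j"
  using assms by (simp add: mat2_mult_def mat2_def finsum_UNIV_2)

lemma mat2_mult_closed: "A \<in> mat2 R \<Longrightarrow> B \<in> mat2 R \<Longrightarrow> mat2_mult R A B \<in> mat2 R"
  by (simp add: in_mat2_iff mat2_mult_nth)

lemma mat2_minus_closed: "A \<in> mat2 R \<Longrightarrow> B \<in> mat2 R \<Longrightarrow> mat2_minus R A B \<in> mat2 R"
  by (simp add: in_mat2_iff mat2_minus_def)

lemma engel_closed: "A \<in> mat2 R \<Longrightarrow> B \<in> mat2 R \<Longrightarrow> engel R n A B \<in> mat2 R"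
  by (induction n) (simp_all add: mat2_mult_closed mat2_minus_closed)

lemma mat2_trace_eq: "A \<in> mat2 R \<Longrightarrow> mat2_trace R A = A $ 1 $ 1 \<oplus> A $ 2 $ 2"
  by (simp add: mat2_trace_def in_mat2_iff finsum_UNIV_2)

lemma traceless2_closed:
  "a \<in> carrier R \<Longrightarrow> b \<in> carrier R \<Longrightarrow> c \<in> carrier R \<Longrightarrow> traceless2 R a b c \<in> mat2 R"
  by (simp add: in_mat2_iff)

lemma sl2_eq_traceless2:
  assumes "A \<in> sl2 R"
  shows "A = traceless2 R (A $ 1 $ 1) (A $ 1 $ 2) (A $ 2 $ 1)"
proof -
  have "A \<in> mat2 R" "A $ 1 $ 1 \<oplus> A $ 2 $ 2 = \<zero>"
    using assms by (auto simp: sl2_def mat2_trace_eq)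
  then have "A $ 2 $ 2 = \<ominus> (A $ 1 $ 1)"
    by (metis add.inv_comm in_mat2_iff minus_equality)
  then show ?thesis
    by (intro mat2_eqI) simp_all
qed

text \<open>These are the diagonal entries of AB - BA for A with rows (a, b), (c, d) and B with rows
  (p, q), (r, s), written as ring elements so that \<open>algebra\<close> applies.\<close>

lemma commutator_trace_zero:
  assumes carr: "a \<in> carrier R" "b \<in> carrier R" "c \<in> carrier R" "d \<in> carrier R"
    "p \<in> carrier R" "q \<in> carrier R" "r \<in> carrier R" "s \<in> carrier R"
  shows "((a \<otimes> p \<oplus> b \<otimes> r) \<ominus> (p \<otimes> a \<oplus> q \<otimes> c)) \<oplus>
    ((c \<otimes> q \<oplus> d \<otimes> s) \<ominus> (r \<otimes> b \<oplus> s \<otimes> d)) = \<zero>"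
  using carr by algebra

lemma commutator_in_sl2:
  assumes "A \<in> mat2 R" "B \<in> mat2 R"
  shows "mat2_minus R (mat2_mult R A B) (mat2_mult R B A) \<in> sl2 R"
proof -
  let ?C = "mat2_minus R (mat2_mult R A B) (mat2_mult R B A)"
  have C: "?C \<in> mat2 R"
    using assms by (simp add: mat2_minus_closed mat2_mult_closed)
  moreover have "mat2_trace R ?C = \<zero>"
    unfolding mat2_trace_eq[OF C] using assms
    by (simp add: mat2_minus_def mat2_mult_nth commutator_trace_zero in_mat2_iff)
  ultimately show ?thesis
    by (simp add: sl2_def)
qed

lemma engel_image_Suc_subset_sl2: "engel_image R (Suc n) \<subseteq> sl2 R"
  by (auto simp: engel_image_def commutator_in_sl2 engel_closed)

section \<open>Inverting the commutator with Y on the orthogonal complement of Y\<close>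

lemma commutator_traceless2:
  assumes carr [simp]: "a \<in> carrier R" "b \<in> carrier R" "c \<in> carrier R"
    "p \<in> carrier R" "q \<in> carrier R" "r \<in> carrier R"
  shows "mat2_minus R (mat2_mult R (traceless2 R a b c) (traceless2 R p q r))
      (mat2_mult R (traceless2 R p q r) (traceless2 R a b c)) =
    traceless2 R (b \<otimes> r \<ominus> c \<otimes> q) ((\<one> \<oplus> \<one>) \<otimes> (a \<otimes> q \<ominus> b \<otimes> p)) ((\<one> \<oplus> \<one>) \<otimes> (c \<otimes> p \<ominus> a \<otimes> r))"
proof -
  \<comment> \<open>One identity per matrix entry. Up to order and the factor 2 off the diagonal,
    the coordinates are those of the cross product of (a, b, c) and (p, q, r).\<close>
  have "a \<otimes> p \<oplus> b \<otimes> r \<ominus> (p \<otimes> a \<oplus> q \<otimes> c) = b \<otimes> r \<ominus> c \<otimes> q"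
    using carr by algebra
  moreover have "a \<otimes> q \<oplus> b \<otimes> (\<ominus> p) \<ominus> (p \<otimes> b \<oplus> q \<otimes> (\<ominus> a)) = (\<one> \<oplus> \<one>) \<otimes> (a \<otimes> q \<ominus> b \<otimes> p)"
    using carr by algebra
  moreover have "c \<otimes> p \<oplus> (\<ominus> a) \<otimes> r \<ominus> (r \<otimes> a \<oplus> (\<ominus> p) \<otimes> c) = (\<one> \<oplus> \<one>) \<otimes> (c \<otimes> p \<ominus> a \<otimes> r)"
    using carr by algebra
  moreover have "c \<otimes> q \<oplus> (\<ominus> a) \<otimes> (\<ominus> p) \<ominus> (r \<otimes> b \<oplus> (\<ominus> p) \<otimes> (\<ominus> a)) = \<ominus> (b \<otimes> r \<ominus> c \<otimes> q)"
    using carr by algebra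
  ultimately show ?thesis
    by (intro mat2_eqI) (simp_all add: mat2_minus_def mat2_mult_nth traceless2_closed)
qed

text \<open>Let X and Y have coordinates (a, b, c) and (p, q, r). The trace of XY is 2ap + br + cq,
  so \<open>orth\<close> says that X is orthogonal to Y, and \<open>unit\<close> says that 4d is a
  unit, where d = pp + qr and YY = dI. Since [[X, Y], Y] = 4d X for such X, the preimage is [X, Y] /
  4d. It is again orthogonal to Y, which allows iteration.\<close>

lemma commutator_preimage:
  assumes carr [simp]: "a \<in> carrier R" "b \<in> carrier R" "c \<in> carrier R"
    "p \<in> carrier R" "q \<in> carrier R" "r \<in> carrier R"
    and orth: "b \<otimes> r \<oplus> c \<otimes> q = \<ominus> ((\<one> \<oplus> \<one>) \<otimes> (a \<otimes> p))"
    and unit: "(\<one> \<oplus> \<one>) \<otimes> (\<one> \<oplus> \<one>) \<otimes> (p \<otimes> p \<oplus> q \<otimes> r) \<in> Units R"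
  obtains a' b' c' where "a' \<in> carrier R" "b' \<in> carrier R" "c' \<in> carrier R"
    "b' \<otimes> r \<oplus> c' \<otimes> q = \<ominus> ((\<one> \<oplus> \<one>) \<otimes> (a' \<otimes> p))"
    "mat2_minus R (mat2_mult R (traceless2 R a' b' c') (traceless2 R p q r))
      (mat2_mult R (traceless2 R p q r) (traceless2 R a' b' c')) = traceless2 R a b c"
proof -
  \<comment> \<open>Keeping 2 as an atom \<open>t\<close> controls the normal forms of
    \<open>algebra\<close>; \<open>double\<close> restores the link where a sum x + x
    arises.\<close>
  define t where "t = \<one> \<oplus> \<one>"
  have t_carr [simp]: "t \<in> carrier R"
    by (simp add: t_def)
  have double: "x \<oplus> x = t \<otimes> x" if "x \<in> carrier R" for x
    using that by (simp add: t_def l_distr)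
  note orth = orth[folded t_def]
  let ?u = "t \<otimes> t \<otimes> (p \<otimes> p \<oplus> q \<otimes> r)"
  define v where "v = inv ?u"
  have v_carr [simp]: "v \<in> carrier R" and v: "v \<otimes> ?u = \<one>"
    using unit by (simp_all add: v_def t_def)
  note carrs = carr t_carr v_carr
  \<comment> \<open>The coordinates of [X, Y], scaled by the inverse \<open>v\<close> of 4d.\<close>
  define a' where "a' = v \<otimes> (b \<otimes> r \<ominus> c \<otimes> q)"
  define b' where "b' = v \<otimes> (t \<otimes> (a \<otimes> q \<ominus> b \<otimes> p))"
  define c' where "c' = v \<otimes> (t \<otimes> (c \<otimes> p \<ominus> a \<otimes> r))"
  have carr' [simp]: "a' \<in> carrier R" "b' \<in> carrier R" "c' \<in> carrier R"
    by (simp_all add: a'_def b'_def c'_def)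
  have orth': "b' \<otimes> r \<oplus> c' \<otimes> q = \<ominus> (t \<otimes> (a' \<otimes> p))"
    unfolding a'_def b'_def c'_def using carrs by algebra
  \<comment> \<open>The expression is arranged so that br + cq appears and \<open>orth\<close> can
    turn it into a multiple of ap.\<close>
  have "b' \<otimes> r \<ominus> c' \<otimes> q =
      v \<otimes> t \<otimes> ((a \<otimes> q \<otimes> r \<oplus> a \<otimes> q \<otimes> r) \<ominus> p \<otimes> (b \<otimes> r \<oplus> c \<otimes> q))"
    unfolding b'_def c'_def using carrs by algebra
  also have "\<dots> = v \<otimes> t \<otimes> (t \<otimes> (a \<otimes> q \<otimes> r) \<ominus> p \<otimes> (\<ominus> (t \<otimes> (a \<otimes> p))))"
    by (simp only: orth double carrs m_closed)
  also have "\<dots> = v \<otimes> ?u \<otimes> a"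
    using carrs by algebra
  finally have 1: "b' \<otimes> r \<ominus> c' \<otimes> q = a"
    by (simp add: v)
  \<comment> \<open>Here \<open>orth\<close> is used from right to left: replacing -2ap by br + cq
    cancels the term in c and doubles the term brq. The third coordinate below is symmetric.\<close>
  have "t \<otimes> (a' \<otimes> q \<ominus> b' \<otimes> p) =
      v \<otimes> t \<otimes> (b \<otimes> r \<otimes> q \<ominus> c \<otimes> q \<otimes> q \<oplus> t \<otimes> (b \<otimes> p \<otimes> p) \<oplus> q \<otimes> (\<ominus> (t \<otimes> (a \<otimes> p))))"
    unfolding a'_def b'_def using carrs by algebra
  also have "\<dots> = v \<otimes> t \<otimes> ((b \<otimes> r \<otimes> q \<oplus> b \<otimes> r \<otimes> q) \<oplus> t \<otimes> (b \<otimes> p \<otimes> p))"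
    unfolding orth[symmetric] using carrs by algebra
  also have "\<dots> = v \<otimes> t \<otimes> (t \<otimes> (b \<otimes> r \<otimes> q) \<oplus> t \<otimes> (b \<otimes> p \<otimes> p))"
    by (simp only: double carrs m_closed)
  also have "\<dots> = v \<otimes> ?u \<otimes> b"
    using carrs by algebra
  finally have 2: "t \<otimes> (a' \<otimes> q \<ominus> b' \<otimes> p) = b"
    by (simp add: v)
  have "t \<otimes> (c' \<otimes> p \<ominus> a' \<otimes> r) =
      v \<otimes> t \<otimes> (c \<otimes> q \<otimes> r \<ominus> b \<otimes> r \<otimes> r \<oplus> t \<otimes> (c \<otimes> p \<otimes> p) \<oplus> r \<otimes> (\<ominus> (t \<otimes> (a \<otimes> p))))"
    unfolding a'_def c'_def using carrs by algebra
  also have "\<dots> = v \<otimes> t \<otimes> ((c \<otimes> q \<otimes> r \<oplus> c \<otimes> q \<otimes> r) \<oplus> t \<otimes> (c \<otimes> p \<otimes> p))"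
    unfolding orth[symmetric] using carrs by algebra
  also have "\<dots> = v \<otimes> t \<otimes> (t \<otimes> (c \<otimes> q \<otimes> r) \<oplus> t \<otimes> (c \<otimes> p \<otimes> p))"
    by (simp only: double carrs m_closed)
  also have "\<dots> = v \<otimes> ?u \<otimes> c"
    using carrs by algebra
  finally have 3: "t \<otimes> (c' \<otimes> p \<ominus> a' \<otimes> r) = c"
    by (simp add: v)
  show thesis
    using that[folded t_def, OF carr' orth'] by (simp add: commutator_traceless2[folded t_def] 1 2 3)
qed

text \<open>Induction with Y fixed and the target varying: \<open>commutator_preimage\<close> peels
  off the outermost commutator and returns a target that is still orthogonal to Y. At 0 the Engel
  map returns its first argument, so the target itself serves.\<close>

lemma traceless2_in_engel_image:
  assumes "a \<in> carrier R" "b \<in> carrier R" "c \<in> carrier R"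
    and pqr: "p \<in> carrier R" "q \<in> carrier R" "r \<in> carrier R"
    and orth: "b \<otimes> r \<oplus> c \<otimes> q = \<ominus> ((\<one> \<oplus> \<one>) \<otimes> (a \<otimes> p))"
    and unit: "(\<one> \<oplus> \<one>) \<otimes> (\<one> \<oplus> \<one>) \<otimes> (p \<otimes> p \<oplus> q \<otimes> r) \<in> Units R"
  shows "traceless2 R a b c \<in> engel_image R n"
proof -
  have "\<exists>A \<in> mat2 R. engel R n A (traceless2 R p q r) = traceless2 R a b c"
    using assms(1-3) orth
  proof (induction n arbitrary: a b c)
    case 0
    then show ?case
      by (auto simp: traceless2_closed)
  next
    case (Suc n)
    from commutator_preimage[OF Suc.prems(1-3) pqr Suc.prems(4) unit]
    obtain a' b' c' where abc: "a' \<in> carrier R" "b' \<in> carrier R" "c' \<in> carrier R"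
      "b' \<otimes> r \<oplus> c' \<otimes> q = \<ominus> ((\<one> \<oplus> \<one>) \<otimes> (a' \<otimes> p))"
      "mat2_minus R (mat2_mult R (traceless2 R a' b' c') (traceless2 R p q r))
        (mat2_mult R (traceless2 R p q r) (traceless2 R a' b' c')) = traceless2 R a b c"
      by blast
    from Suc.IH[OF abc(1-4)] obtain A where "A \<in> mat2 R"
      "engel R n A (traceless2 R p q r) = traceless2 R a' b' c'"
      by blast
    with abc(5) show ?case
      by (intro bexI[of _ A]) simp_all
  qed
  then show ?thesis
    using traceless2_closed[OF pqr] unfolding engel_image_def by force
qed

section \<open>Orthogonal matrices with invertible square\<close>

lemma nonunit_mult:
  assumes "x \<in> carrier R" "y \<in> carrier R" "y \<notin> Units R"
  shows "x \<otimes> y \<notin> Units R"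
  using assms unit_factor m_comm by metis

text \<open>If an off-diagonal entry is a unit, Y can be chosen triangular with that unit on its
  diagonal, so that d is its square. Otherwise a is a unit, and d is made the sum of the unit 4aa
  and the nonunit (b + c)(b + c). The hypothesis \<open>nonunits_add\<close> expresses locality
  without naming an ideal.\<close>

lemma orthogonal_nonisotropic:
  assumes carr [simp]: "a \<in> carrier R" "b \<in> carrier R" "c \<in> carrier R"
    and unimod: "a \<in> Units R \<or> b \<in> Units R \<or> c \<in> Units R"
    and two: "\<one> \<oplus> \<one> \<in> Units R"
    and nonunits_add: "\<And>x y. x \<in> carrier R - Units R \<Longrightarrow> y \<in> carrier R - Units R \<Longrightarrow> x \<oplus> y \<notin> Units R"
  obtains p q r where "p \<in> carrier R" "q \<in> carrier R" "r \<in> carrier R"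
    "b \<otimes> r \<oplus> c \<otimes> q = \<ominus> ((\<one> \<oplus> \<one>) \<otimes> (a \<otimes> p))" "p \<otimes> p \<oplus> q \<otimes> r \<in> Units R"
proof -
  let ?t = "\<one> \<oplus> \<one>"
  consider "c \<in> Units R" | "b \<in> Units R" | "a \<in> Units R" "b \<notin> Units R" "c \<notin> Units R"
    using unimod by blast
  then show thesis
  proof cases
    case 1
    have "b \<otimes> \<zero> \<oplus> c \<otimes> (\<ominus> (?t \<otimes> a)) = \<ominus> (?t \<otimes> (a \<otimes> c))"
      using carr by algebra
    with 1 show thesis
      by (intro that[of c "\<ominus> (?t \<otimes> a)" \<zero>]) auto
  next
    case 2
    have "b \<otimes> (\<ominus> (?t \<otimes> a)) \<oplus> c \<otimes> \<zero> = \<ominus> (?t \<otimes> (a \<otimes> b))"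
      using carr by algebra
    with 2 show thesis
      by (intro that[of b \<zero> "\<ominus> (?t \<otimes> a)"]) auto
  next
    case 3
    \<comment> \<open>Taking q = r = 2a reduces orthogonality to 2a(b + c) = -2ap, which dictates
      this p.\<close>
    let ?p = "\<ominus> (b \<oplus> c)" and ?q = "?t \<otimes> a"
    have "b \<otimes> ?q \<oplus> c \<otimes> ?q = \<ominus> (?t \<otimes> (a \<otimes> ?p))"
      using carr by algebra
    moreover have "?p \<otimes> ?p \<oplus> ?q \<otimes> ?q \<in> Units R"
    \<comment> \<open>If d were a nonunit, then 4aa = d - (b + c)(b + c) would be a sum of two
      nonunits, although 2 and a are units.\<close>
    proof (rule ccontr)
      assume "?p \<otimes> ?p \<oplus> ?q \<otimes> ?q \<notin> Units R"
      moreover have "?q \<otimes> ?q = (?p \<otimes> ?p \<oplus> ?q \<otimes> ?q) \<oplus> (b \<oplus> c) \<otimes> (\<ominus> (b \<oplus> c))"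
        using carr by algebra
      moreover have "(\<ominus> (b \<oplus> c)) \<otimes> (b \<oplus> c) \<notin> Units R"
        using 3 nonunits_add by (intro nonunit_mult) auto
      ultimately have "?q \<otimes> ?q \<notin> Units R"
        using nonunits_add[of "?p \<otimes> ?p \<oplus> ?q \<otimes> ?q" "(b \<oplus> c) \<otimes> (\<ominus> (b \<oplus> c))"]
        by (metis DiffI a_closed a_inv_closed carr m_closed m_comm one_closed)
      with 3 two show False
        by auto
    qed
    ultimately show thesis
      by (intro that[of ?p ?q ?q]) auto
  qed
qed

text \<open>Write the target as g times a matrix with a unit entry and choose Y orthogonal to the
  latter. Orthogonality is linear in the target, so the same Y works for the multiple, even when g
  is a nonunit.\<close>

lemma engel_image_eq_sl2:
  assumes two: "\<one> \<oplus> \<one> \<in> Units R"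
    and nonunits_add: "\<And>x y. x \<in> carrier R - Units R \<Longrightarrow> y \<in> carrier R - Units R \<Longrightarrow> x \<oplus> y \<notin> Units R"
    and unimod: "unimodular_multiples R"
  shows "engel_image R (Suc n) = sl2 R"
proof (rule subset_antisym[OF engel_image_Suc_subset_sl2], rule subsetI)
  fix A assume A: "A \<in> sl2 R"
  then have "A \<in> mat2 R"
    by (simp add: sl2_def)
  then have "A $ 1 $ 1 \<in> carrier R" "A $ 1 $ 2 \<in> carrier R" "A $ 2 $ 1 \<in> carrier R"
    by (simp_all add: in_mat2_iff)
  from unimod[unfolded unimodular_multiples_def, rule_format, OF this] obtain g x y z where carr: "g \<in> carrier R" "x \<in> carrier R" "y \<in> carrier R" "z \<in> carrier R"
    and eqs: "A $ 1 $ 1 = g \<otimes> x" "A $ 1 $ 2 = g \<otimes> y" "A $ 2 $ 1 = g \<otimes> z"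
    and xyz: "x \<in> Units R \<or> y \<in> Units R \<or> z \<in> Units R"
    by (elim bexE conjE) (rule that)
  obtain p q r where pqr: "p \<in> carrier R" "q \<in> carrier R" "r \<in> carrier R"
    and orth: "y \<otimes> r \<oplus> z \<otimes> q = \<ominus> ((\<one> \<oplus> \<one>) \<otimes> (x \<otimes> p))"
    and unit: "p \<otimes> p \<oplus> q \<otimes> r \<in> Units R"
    using orthogonal_nonisotropic[OF carr(2-4) xyz two nonunits_add] by blast
  note [simp] = carr pqr
  have "g \<otimes> y \<otimes> r \<oplus> g \<otimes> z \<otimes> q = g \<otimes> (y \<otimes> r \<oplus> z \<otimes> q)"
    using carr pqr by algebra
  also have "\<dots> = \<ominus> ((\<one> \<oplus> \<one>) \<otimes> (g \<otimes> x \<otimes> p))"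
    unfolding orth using carr pqr by algebra
  finally have "traceless2 R (g \<otimes> x) (g \<otimes> y) (g \<otimes> z) \<in> engel_image R (Suc n)"
    using two unit by (intro traceless2_in_engel_image[of _ _ _ p q r]) auto
  with sl2_eq_traceless2[OF A] eqs show "A \<in> engel_image R (Suc n)"
    by simp
qed

section \<open>Maximal ideals containing a given nonunit\<close>

lemma nonunit_in_maximalideal:
  assumes "noetherian_ring R" "x \<in> carrier R" "x \<notin> Units R"
  obtains M where "maximalideal M R" "x \<in> M"
proof -
  interpret noetherian_ring R by fact
  let ?S = "{I. ideal I R \<and> x \<in> I \<and> \<one> \<notin> I}"
  have "\<one> \<notin> PIdl x"
    using assms(2,3) m_comm unfolding cgenideal_def Units_def by fastforce
  then have "PIdl x \<in> ?S"
    using assms(2) by (simp add: cgenideal_ideal cgenideal_self)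
  \<comment> \<open>In a noetherian ring the union of a nonempty chain of ideals is a member of the
    chain, which supplies the upper bounds for Zorn's lemma.\<close>
  moreover have chain: "\<Union>C \<in> ?S" if "C \<noteq> {}" "subset.chain ?S C" for C
  proof -
    have "subset.chain {I. ideal I R} C"
      using that(2) by (auto simp: subset_chain_def)
    with that show ?thesis
      using ideal_chain_is_trivial[of C] by (auto simp: subset_chain_def)
  qed
  ultimately have "\<exists>M \<in> ?S. \<forall>J \<in> ?S. M \<subseteq> J \<longrightarrow> J = M"
    by (intro subset_Zorn_nonempty chain) auto
  then obtain M where M: "M \<in> ?S" and max: "\<And>J. J \<in> ?S \<Longrightarrow> M \<subseteq> J \<Longrightarrow> J = M"
    by blast
  have "maximalideal M R"
  proof (rule maximalidealI)
    show "ideal M R"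
      using M by simp
    show "carrier R \<noteq> M"
      using M one_closed by auto
    fix J assume J: "ideal J R" "M \<subseteq> J" "J \<subseteq> carrier R"
    show "J = M \<or> J = carrier R"
    \<comment> \<open>An ideal above \<open>M\<close> contains \<open>x\<close>, so it belongs to
      \<open>?S\<close> unless it contains \<open>\<one>\<close>. Hence maximality in
      \<open>?S\<close> is maximality among all proper ideals.\<close>
    proof (cases "\<one> \<in> J")
      case True
      with ideal.one_imp_carrier[OF J(1)] show ?thesis
        by simp
    next
      case False
      with M J have "J \<in> ?S"
        by auto
      with max J(2) show ?thesis
        by simp
    qed
  qed
  moreover have "x \<in> M"
    using M by simp
  ultimately show thesis
    by (rule that)
qed

end

section \<open>Local principal ideal rings: nonunits and common divisors\<close>

lemma principal_ideal_ring_noetherian: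
  fixes R (structure)
  assumes "principal_ideal_ring R"
  shows "noetherian_ring R"
proof -
  interpret cring R
    using assms by (simp add: principal_ideal_ring_def)
  show ?thesis
  proof (rule noetherian_ringI)
    fix I assume "ideal I R"
    then have "principalideal I R"
      using assms by (simp add: principal_ideal_ring_def)
    from principalideal.generate[OF this] show "\<exists>A \<subseteq> carrier R. finite A \<and> I = Idl A"
      by (metis bot_least finite.emptyI finite_insert insert_subset)
  qed
qed

text \<open>Each nonunit lies in some maximal ideal, and \<open>M\<close> is the only one. Closure
  of the nonunits under addition follows, since \<open>M\<close> is an ideal.\<close>

lemma local_nonunits:
  fixes R (structure)
  assumes "principal_ideal_ring R" "local_ring_with R M"
  shows "carrier R - Units R = M"
proof -
  interpret cring R
    using assms by (simp add: principal_ideal_ring_def)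
  have M: "maximalideal M R" and uniq: "\<And>I. maximalideal I R \<Longrightarrow> I = M"
    using assms(2) by (auto simp: local_ring_with_def)
  interpret M: maximalideal M R by (rule M)
  have "x \<notin> M" if "x \<in> Units R" for x
  proof
    assume "x \<in> M"
    then have "inv x \<otimes> x \<in> M"
      using that M.I_l_closed by blast
    then show False
      using that M.one_imp_carrier M.I_notcarr by simp
  qed
  moreover have "x \<in> M" if "x \<in> carrier R" "x \<notin> Units R" for x
    using nonunit_in_maximalideal[OF principal_ideal_ring_noetherian[OF assms(1)] that] uniq by metis
  ultimately show ?thesis
    using M.a_subset by auto
qed

text \<open>Let g generate the ideal (a, b, c), with (a, b, c) = g (x, y, z) and g = ua + vb + wc.
  For e = ux + vy + wz this gives (1 - e) g = 0. Zero divisors may occur, so g is not cancelled;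
  instead, if x, y, z are all nonunits, then e lies in \<open>M\<close>, 1 - e is a unit and g =
  0.\<close>

lemma local_unimodular_multiples:
  fixes R (structure)
  assumes "principal_ideal_ring R" "local_ring_with R M"
  shows "unimodular_multiples R"
  unfolding unimodular_multiples_def
proof (intro ballI)
  interpret cring R
    using assms by (simp add: principal_ideal_ring_def)
  have "maximalideal M R"
    using assms(2) by (auto simp: local_ring_with_def)
  then interpret M: maximalideal M R .
  note nonunits = local_nonunits[OF assms]
  fix a b c assume [simp]: "a \<in> carrier R" "b \<in> carrier R" "c \<in> carrier R"
  let ?I = "PIdl a <+>\<^bsub>R\<^esub> PIdl b <+>\<^bsub>R\<^esub> PIdl c"
  have "principalideal ?I R"
    using assms(1) by (simp add: principal_ideal_ring_def add_ideals cgenideal_ideal)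
  then obtain g where g [simp]: "g \<in> carrier R" and I: "?I = PIdl g"
    using principalideal.generate cgenideal_eq_genideal by metis
  have mem: "u \<otimes> a \<oplus> v \<otimes> b \<oplus> w \<otimes> c \<in> PIdl g"
    if "u \<in> carrier R" "v \<in> carrier R" "w \<in> carrier R" for u v w
  proof -
    have "u \<otimes> a \<oplus> v \<otimes> b \<oplus> w \<otimes> c \<in> ?I"
      unfolding set_add_def' cgenideal_def using that by blast
    then show ?thesis
      by (simp only: I)
  qed
  \<comment> \<open>Each of a, b, c is a combination with one coefficient 1 and the others
    0.\<close>
  have "a \<in> PIdl g" "b \<in> PIdl g" "c \<in> PIdl g"
    using mem[of \<one> \<zero> \<zero>] mem[of \<zero> \<one> \<zero>] mem[of \<zero> \<zero> \<one>] by simp_all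
  then obtain x y z where carr [simp]: "x \<in> carrier R" "y \<in> carrier R" "z \<in> carrier R"
    and xyz: "a = x \<otimes> g" "b = y \<otimes> g" "c = z \<otimes> g"
    unfolding cgenideal_def by blast
  have "g \<in> ?I"
    unfolding I by (rule cgenideal_self) simp
  then obtain u v w where uvw_carr [simp]: "u \<in> carrier R" "v \<in> carrier R" "w \<in> carrier R"
    and uvw: "g = u \<otimes> a \<oplus> v \<otimes> b \<oplus> w \<otimes> c"
    unfolding set_add_def' cgenideal_def by blast
  show "\<exists>g \<in> carrier R. \<exists>x \<in> carrier R. \<exists>y \<in> carrier R. \<exists>z \<in> carrier R.
    a = g \<otimes> x \<and> b = g \<otimes> y \<and> c = g \<otimes> z \<and> (x \<in> Units R \<or> y \<in> Units R \<or> z \<in> Units R)"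
  proof (cases "x \<in> Units R \<or> y \<in> Units R \<or> z \<in> Units R")
    case True
    moreover have "a = g \<otimes> x" "b = g \<otimes> y" "c = g \<otimes> z"
      using xyz by (simp_all add: m_comm)
    ultimately show ?thesis
      using carr g by blast
  next
    case False
    then have "x \<in> M" "y \<in> M" "z \<in> M"
      by (simp_all add: nonunits[symmetric])
    define e where "e = u \<otimes> x \<oplus> v \<otimes> y \<oplus> w \<otimes> z"
    have "e \<in> M"
      unfolding e_def using \<open>x \<in> M\<close> \<open>y \<in> M\<close> \<open>z \<in> M\<close> by (simp add: M.I_l_closed)
    then have [simp]: "e \<in> carrier R"
      by (rule M.a_Hcarr)
    have "\<one> \<ominus> e \<in> Units R"
    proof (rule ccontr)
      assume "\<one> \<ominus> e \<notin> Units R"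
      then have "\<one> \<ominus> e \<in> M"
        by (simp add: nonunits[symmetric])
      then have "(\<one> \<ominus> e) \<oplus> e \<in> M"
        using \<open>e \<in> M\<close> by simp
      moreover have "(\<one> \<ominus> e) \<oplus> e = \<one>"
        using \<open>e \<in> carrier R\<close> by algebra
      ultimately show False
        using nonunits by auto
    qed
    moreover have "(\<one> \<ominus> e) \<otimes> g = g \<ominus> (u \<otimes> (x \<otimes> g) \<oplus> v \<otimes> (y \<otimes> g) \<oplus> w \<otimes> (z \<otimes> g))"
      unfolding e_def using carr uvw_carr g by algebra
    then have "(\<one> \<ominus> e) \<otimes> g = (\<one> \<ominus> e) \<otimes> \<zero>"
      using uvw unfolding xyz by (simp add: r_neg minus_eq)
    ultimately have "g = \<zero>"
      by (metis Units_l_cancel g zero_closed)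
    \<comment> \<open>The triple is zero, so the factor 0 with cofactors 1 replaces g, x, y,
      z.\<close>
    then have "a = \<zero> \<otimes> \<one>" "b = \<zero> \<otimes> \<one>" "c = \<zero> \<otimes> \<one>"
      using xyz by simp_all
    then show ?thesis
      using Units_one_closed one_closed zero_closed by blast
  qed
qed

lemma (in field) unimodular_multiples_field: "unimodular_multiples R"
  unfolding unimodular_multiples_def
proof (intro ballI)
  fix a b c assume abc [simp]: "a \<in> carrier R" "b \<in> carrier R" "c \<in> carrier R"
  show "\<exists>g \<in> carrier R. \<exists>x \<in> carrier R. \<exists>y \<in> carrier R. \<exists>z \<in> carrier R.
    a = g \<otimes> x \<and> b = g \<otimes> y \<and> c = g \<otimes> z \<and> (x \<in> Units R \<or> y \<in> Units R \<or> z \<in> Units R)"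
  proof (cases "a = \<zero> \<and> b = \<zero> \<and> c = \<zero>")
    case True
    then have "a = \<zero> \<otimes> \<one>" "b = \<zero> \<otimes> \<one>" "c = \<zero> \<otimes> \<one>"
      by simp_all
    then show ?thesis
      using Units_one_closed one_closed zero_closed by blast
  next
    case False
    then have "a \<in> Units R \<or> b \<in> Units R \<or> c \<in> Units R"
      by (auto simp: field_Units)
    moreover have "a = \<one> \<otimes> a" "b = \<one> \<otimes> b" "c = \<one> \<otimes> c"
      by simp_all
    ultimately show ?thesis
      using abc one_closed by blast
  qed
qed

section \<open>Characteristic and invertibility of 2\<close>

lemma (in ring) characteristic_eq_2:
  assumes "\<one> \<oplus> \<one> = \<zero>" "\<one> \<noteq> \<zero>"
  shows "characteristic R = 2"
proof -
  let ?o = "add.ord \<one>"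
  have pow: "add_pow R n \<one> = \<zero> \<longleftrightarrow> ?o dvd n" for n :: nat
    using add.pow_eq_id[of \<one> n] by simp
  have "?o dvd 2"
    using assms(1) by (simp add: pow[symmetric] numeral_2_eq_2)
  moreover have "\<not> ?o dvd 1"
    using assms(2) by (simp only: pow[symmetric]) simp
  \<comment> \<open>The additive order of \<open>\<one>\<close> divides the prime 2 and differs from
    1.\<close>
  ultimately have "?o = 2"
    by (metis dvd_refl two_is_prime_nat prime_nat_iff)
  then show ?thesis
    by (simp add: characteristic_def)
qed

text \<open>If 2 were in \<open>M\<close>, it would vanish in the residue field, whose
  characteristic would then be 2. Outside \<open>M\<close> every element of the local ring is a
  unit.\<close>

lemma two_unit_if_residue_characteristic:
  fixes R (structure)
  assumes "principal_ideal_ring R" "local_ring_with R M" "characteristic (R Quot M) \<noteq> 2"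
  shows "\<one> \<oplus> \<one> \<in> Units R"
proof -
  interpret cring R
    using assms(1) by (simp add: principal_ideal_ring_def)
  have "maximalideal M R"
    using assms(2) by (auto simp: local_ring_with_def)
  then interpret M: maximalideal M R .
  interpret k: field "R Quot M"
    by (rule M.quotient_is_field[OF is_cring])
  have "\<one> \<oplus> \<one> \<notin> M"
  proof
    assume "\<one> \<oplus> \<one> \<in> M"
    then have "M +> (\<one> \<oplus> \<one>) = \<zero>\<^bsub>R Quot M\<^esub>"
      by (simp only: M.a_rcos_const FactRing_def ring.simps)
    moreover have "M +> (\<one> \<oplus> \<one>) = \<one>\<^bsub>R Quot M\<^esub> \<oplus>\<^bsub>R Quot M\<^esub> \<one>\<^bsub>R Quot M\<^esub>"
      using ring_hom_add[OF M.rcos_ring_hom] ring_hom_one[OF M.rcos_ring_hom] one_closed by metis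
    ultimately have "\<one>\<^bsub>R Quot M\<^esub> \<oplus>\<^bsub>R Quot M\<^esub> \<one>\<^bsub>R Quot M\<^esub> = \<zero>\<^bsub>R Quot M\<^esub>"
      by (simp only:)
    with k.characteristic_eq_2 assms(3) k.one_not_zero show False
      by blast
  qed
  then show ?thesis
    using local_nonunits[OF assms(1,2)] by auto
qed

section \<open>Surjectivity over the ring and over its residue field\<close>

theorem theorem4p4:
  fixes R :: "('a, 'b) ring_scheme" and M :: "'a set" and \<pi> :: 'a and m :: nat
  assumes "principal_ideal_ring R"
    and "local_ring_with R M"
    and "\<pi> \<in> carrier R" and "M = PIdl\<^bsub>R\<^esub> \<pi>"
    and "adic_complete R M"
    and "characteristic (R Quot M) \<noteq> 2"
    and "m \<ge> 1"
  shows "engel_image R (m + 1) = sl2 R \<longleftrightarrow> engel_image (R Quot M) (m + 1) = sl2 (R Quot M)"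
proof -
  interpret cring R
    using assms(1) by (simp add: principal_ideal_ring_def)
  have "maximalideal M R"
    using assms(2) by (auto simp: local_ring_with_def)
  then interpret M: maximalideal M R .
  interpret k: field "R Quot M"
    by (rule M.quotient_is_field[OF is_cring])
  note nonunits = local_nonunits[OF assms(1,2)]
  have "x \<oplus>\<^bsub>R\<^esub> y \<notin> Units R" if "x \<in> carrier R - Units R" "y \<in> carrier R - Units R" for x y
    using that M.a_closed[of x y] by (simp only: nonunits) (simp add: nonunits[symmetric])
  then have "engel_image R (Suc m) = sl2 R"
    using two_unit_if_residue_characteristic[OF assms(1,2,6)] local_unimodular_multiples[OF assms(1,2)]
    by (intro engel_image_eq_sl2)
  \<comment> \<open>The same lemma applies to the residue field: 2 is nonzero there, and the only
    nonunit is zero, so nonunits are closed under addition.\<close>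
  moreover have "engel_image (R Quot M) (Suc m) = sl2 (R Quot M)"
  proof (rule k.engel_image_eq_sl2[OF _ _ k.unimodular_multiples_field])
    show "\<one>\<^bsub>R Quot M\<^esub> \<oplus>\<^bsub>R Quot M\<^esub> \<one>\<^bsub>R Quot M\<^esub> \<in> Units (R Quot M)"
      using k.characteristic_eq_2 assms(6) k.one_not_zero by (auto simp: k.field_Units)
  qed (auto simp: k.field_Units)
  ultimately show ?thesis
    by simp
qed

end
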